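(* Let $N=\frac{n^2-n}{2}$ and $D_i=\begin{pmatrix}0&2\\-2&0\end{pmatrix}$ for $i=1,2,\dots,N$. Then a canonical form of the defining matrix $\mathcal M_q^z(n)$ of $J_q^z(n)$ is $\mathrm{diag}(D_1,D_2,\dots,D_N,0,\dots,0)$.
   Context: $J^z_q(n)$ is the algebra with generators $M_{i,j}$, $1\le i,j\le n$, and relations $M_{i,j}M_{s,t}=M_{s,t}M_{i,j}$ if $(s-i)(t-j)\le0$, and $qM_{i,j}M_{s,t}=q^{-1}M_{s,t}M_{i,j}+(q-q^{-1})M_{i,t}M_{s,j}$ if $i<s$ and $j<t$. Dropping the last terms $(q-q^{-1})M_{i,t}M_{s,j}$ and writing the relations as $x_{i,j}x_{s,t}=q^{h_{[i,j],[s,t]}}x_{s,t}x_{i,j}$ gives the defining matrix: it is the skew-symmetric integer $n^2\times n^2$ matrix $\mathcal M_q^z(n)=(h_{[i,j],[s,t]})$, indexed by pairs in lexicographic order, with $h_{[i,j],[s,t]}=0$ if $(s-i)(t-j)\le 0$, $h_{[i,j],[s,t]}=-2$ if $s>i$ and $t>j$, and $h_{[i,j],[s,t]}=2$ if $s<i$ and $t<j$. A canonical form of a skew-symmetric integer $n^2\times n^2$ matrix $\mathcal M$ is a block diagonal matrix, with $2\times2$ blocks $\begin{pmatrix}0&-m_i\\ m_i&0\end{pmatrix}$ ($m_i\in\mathbb Z$) and possibly a $1\times 1$ zero block, of the form $W\mathcal M W^t$ with $W\in SL(n^2,\mathbb Z)$. *)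

theory Defs
  imports "Jordan_Normal_Form.Determinant"
begin

(* The algebra J_q^z(n) has generators M_{i,j} (1 <= i, j <= n) and relations
     M_{i,j} M_{s,t} = M_{s,t} M_{i,j}                      if (s - i)(t - j) <= 0,
     q M_{i,j} M_{s,t} = q^{-1} M_{s,t} M_{i,j} + (q - q^{-1}) M_{i,t} M_{s,j}
                                                            if i < s and j < t.
   Dropping the terms (q - q^{-1}) M_{i,t} M_{s,j} leaves
     x_{i,j} x_{s,t} = q^h x_{s,t} x_{i,j},
   where h is the value below at the pairs (i,j), (s,t). *)
definition rel_exponent :: "nat \<times> nat \<Rightarrow> nat \<times> nat \<Rightarrow> int" where
  "rel_exponent = (\<lambda>(i, j) (s, t).
     if (int s - int i) * (int t - int j) \<le> 0 then 0
     else if s > i \<and> t > j then - 2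
     else 2)"

(* Matrix indices start at 0 in the library; the k-th pair in lexicographic order
   on {1..n} x {1..n} is therefore counted from k = 0. *)
definition lex_pair :: "nat \<Rightarrow> nat \<Rightarrow> nat \<times> nat" where
  "lex_pair n k = (k div n + 1, k mod n + 1)"

definition defining_matrix :: "nat \<Rightarrow> int mat" where
  "defining_matrix n =
     mat (n\<^sup>2) (n\<^sup>2) (\<lambda>(k, l). rel_exponent (lex_pair n k) (lex_pair n l))"

definition SL_int :: "nat \<Rightarrow> int mat set" where
  "SL_int d = {W \<in> carrier_mat d d. det W = 1}"

definition skew_symmetric_mat :: "int mat \<Rightarrow> bool" where
  "skew_symmetric_mat M \<longleftrightarrow> square_mat M \<and> transpose_mat M = - M"

definition skew_block :: "int \<Rightarrow> int mat" where
  "skew_block m = mat_of_rows_list 2 [[0, - m], [m, 0]]"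

(* The integers m_i may be zero, so in even dimension all blocks are 2 x 2;
   the single 1 x 1 zero block occurs exactly in odd dimension. *)
definition canonical_shape :: "int mat \<Rightarrow> bool" where
  "canonical_shape C \<longleftrightarrow>
     (\<exists>ms. C = diag_block_mat (map skew_block ms) \<or>
           C = diag_block_mat (map skew_block ms @ [0\<^sub>m 1 1]))"

(* A matrix has several canonical forms, so this is a relation and not a function. *)
definition is_canonical_form :: "int mat \<Rightarrow> int mat \<Rightarrow> bool" where
  "is_canonical_form M C \<longleftrightarrow>
     skew_symmetric_mat M \<and> canonical_shape C \<and>
     (\<exists>W \<in> SL_int (dim_row M). C = W * M * transpose_mat W)"

end

theory Submission
  imports Defs
begin

text \<open>
  The defining matrix is the Gram matrix of an alternating form on
  \<open>\<int>\<^sup>n \<otimes> \<int>\<^sup>n\<close>. Reversing the second index turns this form into \<open>- 2\<close> times the form whose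
  value at \<open>e\<^sub>i \<otimes> e\<^sub>j\<close> and \<open>e\<^sub>s \<otimes> e\<^sub>t\<close> is \<open>1\<close> if \<open>i < s\<close> and \<open>t < j\<close>, \<open>- 1\<close> if
  \<open>s < i\<close> and \<open>j < t\<close>, and \<open>0\<close> otherwise. It is \<open>A \<otimes> A\<^sup>T - A\<^sup>T \<otimes> A\<close>, where \<open>A\<close> is the strictly upper
  triangular matrix of ones. Exchanging the two tensor factors changes its sign, so the symmetric
  tensors form an isotropic sublattice. Its rank is \<open>N + n\<close>, hence the kernel has rank at least \<open>n\<close>
  and there are at most \<open>N\<close> hyperbolic planes.

  That exactly \<open>N\<close> planes occur, over the integers, is seen by dualizing the \<open>N\<close> units
  \<open>e\<^sub>i \<otimes> e\<^sub>j\<close> with \<open>i < j\<close> by symmetric tensors. With \<open>\<delta>\<^sub>a = e\<^sub>a - e\<^bsub>a+1\<^esub>\<close>, the linear forms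
  \<open>A(\<delta>\<^sub>a, \<cdot>)\<close> and \<open>A\<^sup>T(\<delta>\<^sub>a, \<cdot>)\<close> are single coordinates up to sign, so the symmetrization of
  \<open>\<delta>\<^sub>a \<otimes> \<delta>\<^sub>b\<close>, with \<open>a < b\<close>, sees among those units only \<open>(a, b + 1)\<close> and, if \<open>a + 1 < b\<close>, also
  \<open>(a + 1, b)\<close>, with opposite signs; \<open>\<delta>\<^sub>a \<otimes> \<delta>\<^sub>a\<close> sees only \<open>(a, a + 1)\<close> (\<open>form_phi_unit\<close>). Summing over nested intervals with a common centre telescopes to tensors
  \<open>\<psi>\<^sub>s\<^sub>t\<close> dual to the units \<open>(s, t)\<close>, \<open>s < t\<close> (\<open>form_psi_unit\<close>).

  Adding suitable \<open>\<psi>\<close> to the units above the diagonal makes these orthogonal to each other, and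
  adding suitable \<open>\<psi>\<close> to the diagonal units puts the latter into the kernel; the result is a symplectic
  family indexed by the grid (\<open>form_symp_basis\<close>). It spans the lattice (\<open>int_span_unit\<close>), so the
  matrix of its coordinates is unimodular; as the kernel is nonzero, the sign of one kernel vector
  can be chosen to make the determinant \<open>1\<close> (\<open>SL_int_fix_sign\<close>).
\<close>

section \<open>The form on the tensor square\<close>

definition grid :: "nat \<Rightarrow> (nat \<times> nat) set" where
  "grid n = {..<n} \<times> {..<n}"

text \<open>
  Pairs above the diagonal are best read as intervals: for them the value is \<open>1\<close> if the second
  interval lies strictly inside the first, \<open>- 1\<close> if it is the other way round.
\<close>

definition nest :: "nat \<times> nat \<Rightarrow> nat \<times> nat \<Rightarrow> int" where
  "nest = (\<lambda>(i, j) (s, t). of_bool (i < s \<and> t < j) - of_bool (s < i \<and> j < t))"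

definition form :: "nat \<Rightarrow> (nat \<times> nat \<Rightarrow> int) \<Rightarrow> (nat \<times> nat \<Rightarrow> int) \<Rightarrow> int" where
  "form n x y = (\<Sum>p\<in>grid n. \<Sum>q\<in>grid n. x p * nest p q * y q)"

definition unit :: "nat \<times> nat \<Rightarrow> nat \<times> nat \<Rightarrow> int" where
  "unit p = (\<lambda>q. of_bool (q = p))"

definition symmetric_tensor :: "(nat \<times> nat \<Rightarrow> int) \<Rightarrow> bool" where
  "symmetric_tensor x \<longleftrightarrow> (\<forall>i j. x (i, j) = x (j, i))"

lemma finite_grid [simp]: "finite (grid n)"
  by (simp add: grid_def)

lemma mem_grid [simp]: "(i, j) \<in> grid n \<longleftrightarrow> i < n \<and> j < n"
  by (simp add: grid_def)

lemma nest_skew: "nest p q = - nest q p"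
  by (cases p; cases q) (auto simp: nest_def)

lemma form_skew: "form n x y = - form n y x"
proof -
  have "form n x y = (\<Sum>q\<in>grid n. \<Sum>p\<in>grid n. x p * nest p q * y q)"
    unfolding form_def by (rule sum.swap)
  also have "\<dots> = (\<Sum>q\<in>grid n. \<Sum>p\<in>grid n. - (y q * nest q p * x p))"
  proof (intro sum.cong refl)
    fix p q :: "nat \<times> nat"
    show "x p * nest p q * y q = - (y q * nest q p * x p)"
      by (subst nest_skew) (simp add: mult_ac)
  qed
  finally show ?thesis by (simp add: form_def sum_negf)
qed

lemma form_add_left: "form n (\<lambda>p. x p + x' p) y = form n x y + form n x' y"
  by (simp add: form_def algebra_simps sum.distrib)

lemma form_diff_left: "form n (\<lambda>p. x p - x' p) y = form n x y - form n x' y"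
  by (simp add: form_def algebra_simps sum_subtractf)

lemma form_sum_left: "form n (\<lambda>p. \<Sum>a\<in>A. f a p) y = (\<Sum>a\<in>A. form n (f a) y)"
proof -
  have "form n (\<lambda>p. \<Sum>a\<in>A. f a p) y
      = (\<Sum>p\<in>grid n. \<Sum>q\<in>grid n. \<Sum>a\<in>A. f a p * nest p q * y q)"
    by (simp add: form_def sum_distrib_right)
  also have "\<dots> = (\<Sum>p\<in>grid n. \<Sum>a\<in>A. \<Sum>q\<in>grid n. f a p * nest p q * y q)"
    by (intro sum.cong refl sum.swap)
  also have "\<dots> = (\<Sum>a\<in>A. \<Sum>p\<in>grid n. \<Sum>q\<in>grid n. f a p * nest p q * y q)"
    by (rule sum.swap)
  finally show ?thesis by (simp add: form_def)
qed

lemma form_unit_right: "q \<in> grid n \<Longrightarrow> form n x (unit q) = (\<Sum>p\<in>grid n. x p * nest p q)"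
  by (simp add: form_def unit_def of_bool_def if_distrib sum.delta cong: if_cong)

lemma form_unit_unit: "p \<in> grid n \<Longrightarrow> q \<in> grid n \<Longrightarrow> form n (unit p) (unit q) = nest p q"
  by (simp add: form_unit_right) (simp add: unit_def of_bool_def if_distrib if_distribR sum.delta cong: if_cong)

text \<open>
  Exchanging the tensor factors fixes both arguments and reverses all the signs of \<^term>\<open>nest\<close>, so
  the value of the form is its own negative.
\<close>

lemma symmetric_isotropic:
  assumes "symmetric_tensor x" "symmetric_tensor y"
  shows "form n x y = 0"
proof -
  have bij: "bij_betw prod.swap (grid n) (grid n)"
    by (auto simp: bij_betw_def grid_def image_def)
  have x: "x (prod.swap p) = x p" and y: "y (prod.swap p) = y p" for p
    using assms by (cases p; simp add: symmetric_tensor_def)+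
  have nest: "nest (prod.swap p) (prod.swap q) = - nest p q" for p q
    by (cases p; cases q) (auto simp: nest_def)
  have "form n x y = (\<Sum>p\<in>grid n. \<Sum>q\<in>grid n. x (prod.swap p) * nest (prod.swap p) q * y q)"
    unfolding form_def by (rule sum.reindex_bij_betw[OF bij, symmetric])
  also have "\<dots> = (\<Sum>p\<in>grid n. \<Sum>q\<in>grid n.
      x (prod.swap p) * nest (prod.swap p) (prod.swap q) * y (prod.swap q))"
    by (intro sum.cong refl sum.reindex_bij_betw[OF bij, symmetric])
  also have "\<dots> = - form n x y"
    by (simp add: x y nest form_def sum_negf)
  finally show ?thesis by simp
qed

section \<open>Symmetric tensors dual to the units above the diagonal\<close>

definition tensor :: "(nat \<Rightarrow> int) \<Rightarrow> (nat \<Rightarrow> int) \<Rightarrow> nat \<times> nat \<Rightarrow> int" where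
  "tensor u v = (\<lambda>(i, j). u i * v j)"

definition delta :: "nat \<Rightarrow> nat \<Rightarrow> int" where
  "delta a = (\<lambda>i. of_bool (i = a) - of_bool (i = a + 1))"

lemma sum_delta_less: "(\<Sum>i<s. delta a i) = of_bool (s = a + 1)"
  by (induction s) (auto simp: delta_def)

lemma sum_delta_greater:
  assumes "a + 1 < n"
  shows "(\<Sum>i\<in>{s<..<n}. delta a i) = - of_bool (s = a)"
proof -
  have "(\<Sum>i\<in>{s<..<n}. delta a i) = (\<Sum>i\<in>{s<..<n}. of_bool (i = a)) - (\<Sum>i\<in>{s<..<n}. of_bool (i = a + 1))"
    by (simp add: delta_def sum_subtractf)
  also have "\<dots> = of_bool (s < a) - of_bool (s < a + 1)"
    using assms by (simp add: of_bool_def sum.delta)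
  finally show ?thesis by auto
qed

text \<open>
  The form is \<open>A \<otimes> A\<^sup>T - A\<^sup>T \<otimes> A\<close>, so it factors on pure tensors; pairing a vector with a
  basis vector through \<open>A\<close> or \<open>A\<^sup>T\<close> gives its partial sum from the left or from the right.
\<close>

lemma form_tensor_unit:
  assumes "s < n" "t < n"
  shows "form n (tensor u v) (unit (s, t)) =
    (\<Sum>i<s. u i) * (\<Sum>j\<in>{t<..<n}. v j) - (\<Sum>i\<in>{s<..<n}. u i) * (\<Sum>j<t. v j)"
proof -
  have "form n (tensor u v) (unit (s, t)) = (\<Sum>i<n. \<Sum>j<n. u i * v j * nest (i, j) (s, t))"
    using assms by (simp add: form_unit_right tensor_def grid_def sum.cartesian_product case_prod_beta)
  also have "\<dots> = (\<Sum>i<n. \<Sum>j<n. (of_bool (i < s) * u i) * (of_bool (t < j) * v j))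
      - (\<Sum>i<n. \<Sum>j<n. (of_bool (s < i) * u i) * (of_bool (j < t) * v j))"
    unfolding sum_subtractf[symmetric]
    by (intro sum.cong refl) (auto simp: nest_def)
  also have "\<dots> = (\<Sum>i<n. of_bool (i < s) * u i) * (\<Sum>j<n. of_bool (t < j) * v j)
      - (\<Sum>i<n. of_bool (s < i) * u i) * (\<Sum>j<n. of_bool (j < t) * v j)"
    by (simp only: sum_product)
  also have "(\<Sum>i<n. of_bool (i < s) * u i) = (\<Sum>i<s. u i)"
    using assms by (intro sum.mono_neutral_cong_right) auto
  also have "(\<Sum>j<n. of_bool (t < j) * v j) = (\<Sum>j\<in>{t<..<n}. v j)"
    by (intro sum.mono_neutral_cong_right) auto
  also have "(\<Sum>i<n. of_bool (s < i) * u i) = (\<Sum>i\<in>{s<..<n}. u i)"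
    by (intro sum.mono_neutral_cong_right) auto
  also have "(\<Sum>j<n. of_bool (j < t) * v j) = (\<Sum>j<t. v j)"
    using assms by (intro sum.mono_neutral_cong_right) auto
  finally show ?thesis .
qed

text \<open>
  The second argument is shifted by one so that \<open>phi s t\<close> has value \<open>1\<close> on the unit \<open>(s, t)\<close>.
  For \<open>t = s + 1\<close> the symmetrization is twice the square of \<open>delta s\<close>, and only the square itself
  gives the value \<open>1\<close> there.
\<close>

definition phi :: "nat \<Rightarrow> nat \<Rightarrow> nat \<times> nat \<Rightarrow> int" where
  "phi s t = (if t = s + 1 then tensor (delta s) (delta s)
     else (\<lambda>p. tensor (delta s) (delta (t - 1)) p + tensor (delta (t - 1)) (delta s) p))"

text \<open>
  Unfolded, this is the sum of \<open>phi (s + r) (t - r)\<close> over all \<open>r\<close> with \<open>s + r < t - r\<close>.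
\<close>

function psi :: "nat \<Rightarrow> nat \<Rightarrow> nat \<times> nat \<Rightarrow> int" where
  "psi s t = (if s < t then (\<lambda>p. phi s t p + psi (s + 1) (t - 1) p) else (\<lambda>p. 0))"
  by auto
termination by (relation "measure (\<lambda>(s, t). t - s)") auto

declare psi.simps [simp del]

lemma psi_outside: "\<not> s < t \<Longrightarrow> psi s t = (\<lambda>p. 0)"
  by (simp add: psi.simps)

lemma symmetric_phi: "symmetric_tensor (phi s t)"
  by (auto simp: symmetric_tensor_def phi_def tensor_def)

lemma symmetric_psi: "symmetric_tensor (psi s t)"
proof (induction s t rule: psi.induct)
  case (1 s t)
  then show ?case
    using symmetric_phi[of s t] by (subst psi.simps) (auto simp: symmetric_tensor_def)
qed

lemma symmetric_unit_diag: "symmetric_tensor (unit (i, i))"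
  by (auto simp: symmetric_tensor_def unit_def)

text \<open>
  The linear forms that \<open>A\<close> and \<open>A\<^sup>T\<close> attach to \<^term>\<open>delta a\<close> are supported in the coordinates
  \<open>a + 1\<close> and \<open>a\<close>. The transposed summand of \<^term>\<open>phi s t\<close> only meets units on or below the
  diagonal, and so does the second term for \<open>t \<le> s + 2\<close>.
\<close>

lemma form_phi_unit:
  assumes "s < t" "t < n" "i < j" "j < n"
  shows "form n (phi s t) (unit (i, j)) = of_bool (i = s \<and> j = t) - of_bool (s + 1 < t - 1 \<and> i = s + 1 \<and> j = t - 1)"
proof -
  have *: "form n (tensor (delta a) (delta b)) (unit (i, j))
      = of_bool (i = a \<and> j = b + 1) - of_bool (i = a + 1 \<and> j = b)"
    if "a + 1 < n" "b + 1 < n" for a b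
    using assms that by (subst form_tensor_unit) (auto simp: sum_delta_less sum_delta_greater)
  show ?thesis
  proof (cases "t = s + 1")
    case True
    then show ?thesis using assms by (simp add: phi_def *)
  next
    case False
    then show ?thesis using assms by (simp add: phi_def form_add_left *) auto
  qed
qed

text \<open>
  The negative term that \<open>phi s t\<close> contributes cancels against \<open>phi (s + 1) (t - 1)\<close>, down to the
  innermost interval, which has no negative term.
\<close>

lemma form_psi_unit:
  assumes "s < t" "t < n" "i < j" "j < n"
  shows "form n (psi s t) (unit (i, j)) = of_bool (i = s \<and> j = t)"
  using assms
proof (induction s t rule: psi.induct)
  case (1 s t)
  have eq: "form n (psi s t) (unit (i, j))
      = form n (phi s t) (unit (i, j)) + form n (psi (s + 1) (t - 1)) (unit (i, j))"
    using 1(2) by (subst psi.simps) (simp add: form_add_left)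
  show ?case
  proof (cases "s + 1 < t - 1")
    case True
    then have "form n (psi (s + 1) (t - 1)) (unit (i, j)) = of_bool (i = s + 1 \<and> j = t - 1)"
      using 1 by simp
    then show ?thesis using True 1 by (simp add: eq form_phi_unit)
  next
    case False
    then have "form n (psi (s + 1) (t - 1)) (unit (i, j)) = 0"
      by (simp add: psi_outside form_def)
    then show ?thesis using False 1 by (simp add: eq form_phi_unit)
  qed
qed

section \<open>The symplectic basis\<close>

definition inside :: "nat \<Rightarrow> nat \<Rightarrow> (nat \<times> nat) set" where
  "inside i j = {(s, t). i < s \<and> s < t \<and> t < j}"

definition around :: "nat \<Rightarrow> nat \<Rightarrow> (nat \<times> nat) set" where
  "around n i = {(s, t). s < i \<and> i < t \<and> t < n}"

text \<open>
  The form pairs the member \<open>(i, j)\<close> above the diagonal with the member \<open>(j, i)\<close> below it, and the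
  diagonal members span the kernel. Two units above the diagonal have a nonzero value only if one
  interval lies strictly inside the other; the \<open>psi\<close> of the inner interval, subtracted from
  the outer unit, then cancels this value. On the diagonal,
  the correction removes the values on all units above the diagonal.
\<close>

definition symp_basis :: "nat \<Rightarrow> nat \<times> nat \<Rightarrow> nat \<times> nat \<Rightarrow> int" where
  "symp_basis n = (\<lambda>(i, j).
     if i < j then (\<lambda>p. unit (i, j) p - (\<Sum>(s, t)\<in>inside i j. psi s t p))
     else if j < i then psi j i
     else (\<lambda>p. unit (i, i) p + (\<Sum>(s, t)\<in>around n i. psi s t p)))"

lemma symmetric_sum_psi: "symmetric_tensor (\<lambda>p. \<Sum>(s, t)\<in>A. psi s t p)"
  using symmetric_psi by (auto simp: symmetric_tensor_def intro!: sum.cong)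

lemma symmetric_symp_basis: "j \<le> i \<Longrightarrow> symmetric_tensor (symp_basis n (i, j))"
  using symmetric_psi[of j i] symmetric_unit_diag[of i] symmetric_sum_psi[of "around n i"]
  by (auto simp: symp_basis_def symmetric_tensor_def)

lemma form_sum_psi_unit:
  assumes "A \<subseteq> {(s, t). s < t \<and> t < n}" "i < j" "j < n"
  shows "form n (\<lambda>p. \<Sum>(s, t)\<in>A. psi s t p) (unit (i, j)) = of_bool ((i, j) \<in> A)"
proof -
  have fin: "finite A"
    by (rule finite_subset[of _ "{..n} \<times> {..n}"]) (use assms in auto)
  have "form n (\<lambda>p. \<Sum>(s, t)\<in>A. psi s t p) (unit (i, j))
      = (\<Sum>(s, t)\<in>A. form n (psi s t) (unit (i, j)))"
    using form_sum_left[of n "\<lambda>(s, t). psi s t" A] by (simp add: case_prod_beta)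
  also have "\<dots> = (\<Sum>a\<in>A. of_bool (a = (i, j)))"
    using assms by (intro sum.cong refl) (auto simp: form_psi_unit)
  also have "\<dots> = of_bool ((i, j) \<in> A)"
    using fin by (simp add: of_bool_def sum.delta)
  finally show ?thesis .
qed

lemma form_psi_upper:
  assumes "s < t" "t < n" "i < j" "j < n"
  shows "form n (psi s t) (symp_basis n (i, j)) = of_bool (i = s \<and> j = t)"
proof -
  have "form n (symp_basis n (i, j)) (psi s t)
      = form n (unit (i, j)) (psi s t) - form n (\<lambda>p. \<Sum>(s, t)\<in>inside i j. psi s t p) (psi s t)"
    using assms by (simp add: symp_basis_def form_diff_left)
  also have "\<dots> = form n (unit (i, j)) (psi s t)"
    by (simp add: symmetric_isotropic symmetric_psi symmetric_sum_psi)
  finally show ?thesis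
    using form_psi_unit[OF assms] form_skew by metis
qed

lemma form_diag_upper:
  assumes "a < n" "i < j" "j < n"
  shows "form n (symp_basis n (a, a)) (symp_basis n (i, j)) = 0"
proof -
  let ?S = "\<lambda>p. \<Sum>(s, t)\<in>inside i j. psi s t p"
  have sub: "around n a \<subseteq> {(s, t). s < t \<and> t < n}" by (auto simp: around_def)
  have "form n (symp_basis n (i, j)) (symp_basis n (a, a))
      = form n (unit (i, j)) (symp_basis n (a, a)) - form n ?S (symp_basis n (a, a))"
    using assms by (simp add: symp_basis_def[of n] form_diff_left)
  also have "form n ?S (symp_basis n (a, a)) = 0"
    by (simp add: symmetric_isotropic symmetric_symp_basis symmetric_sum_psi)
  also have "form n (unit (i, j)) (symp_basis n (a, a)) = - form n (symp_basis n (a, a)) (unit (i, j))"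
    by (rule form_skew)
  also have "form n (symp_basis n (a, a)) (unit (i, j)) = nest (a, a) (i, j) + of_bool ((i, j) \<in> around n a)"
    using assms sub
    by (simp add: symp_basis_def form_add_left form_unit_unit form_sum_psi_unit)
  also have "\<dots> = 0"
    using assms by (auto simp: nest_def around_def)
  finally show ?thesis using form_skew[of n "symp_basis n (a, a)"] by simp
qed

lemma form_upper_upper:
  assumes "i < j" "j < n" "s < t" "t < n"
  shows "form n (symp_basis n (i, j)) (symp_basis n (s, t)) = 0"
proof -
  let ?S = "\<lambda>i j p. \<Sum>(s, t)\<in>inside i j. psi s t p"
  have inside: "inside i j \<subseteq> {(s, t). s < t \<and> t < n}" if "j < n" for i j
    using that by (auto simp: inside_def)
  have "form n (symp_basis n (i, j)) (symp_basis n (s, t))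
      = form n (unit (i, j)) (symp_basis n (s, t)) - form n (?S i j) (symp_basis n (s, t))"
    using assms by (simp add: symp_basis_def[of n] form_diff_left)
  also have "form n (unit (i, j)) (symp_basis n (s, t)) = - form n (symp_basis n (s, t)) (unit (i, j))"
    by (rule form_skew)
  also have "form n (symp_basis n (s, t)) (unit (i, j)) = nest (s, t) (i, j) - of_bool ((i, j) \<in> inside s t)"
    using assms inside by (simp add: symp_basis_def form_diff_left form_unit_unit form_sum_psi_unit)
  also have "form n (?S i j) (symp_basis n (s, t)) = - form n (symp_basis n (s, t)) (?S i j)"
    by (rule form_skew)
  also have "form n (symp_basis n (s, t)) (?S i j) = form n (unit (s, t)) (?S i j) - form n (?S s t) (?S i j)"
    using assms by (simp add: symp_basis_def[of n] form_diff_left)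
  also have "form n (?S s t) (?S i j) = 0"
    by (simp add: symmetric_isotropic symmetric_sum_psi)
  also have "form n (unit (s, t)) (?S i j) = - form n (?S i j) (unit (s, t))"
    by (rule form_skew)
  also have "form n (?S i j) (unit (s, t)) = of_bool ((s, t) \<in> inside i j)"
    using assms inside by (simp add: form_sum_psi_unit)
  finally show ?thesis
    using assms by (auto simp: inside_def nest_def)
qed

lemma form_symp_basis:
  assumes "p \<in> grid n" "q \<in> grid n"
  shows "form n (symp_basis n p) (symp_basis n q) =
    (if q = prod.swap p then of_bool (snd p < fst p) - of_bool (fst p < snd p) else 0)"
proof -
  obtain i j s t where pq: "p = (i, j)" "q = (s, t)" by (cases p; cases q)
  have bounds: "i < n" "j < n" "s < n" "t < n" using assms pq by auto
  have low: "symp_basis n (a, b) = psi b a" if "b < a" for a b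
    using that by (simp add: symp_basis_def)
  consider "i < j" "s < t" | "j \<le> i" "t \<le> s" | "j < i" "s < t" | "j = i" "s < t"
    | "i < j" "t < s" | "i < j" "t = s"
    by linarith
  then show ?thesis
  proof cases
    case 1
    then show ?thesis using bounds pq by (auto simp: form_upper_upper)
  next
    case 2
    then show ?thesis using pq by (auto simp: symmetric_isotropic symmetric_symp_basis)
  next
    case 3
    then show ?thesis using bounds pq by (auto simp: low form_psi_upper)
  next
    case 4
    then show ?thesis using bounds pq by (auto simp: form_diag_upper)
  next
    case 5
    then show ?thesis using bounds pq
      by (subst form_skew) (auto simp: low form_psi_upper)
  next
    case 6
    then show ?thesis using bounds pq
      by (subst form_skew) (auto simp: form_diag_upper)
  qed
qed

section \<open>The basis spans\<close>

definition int_span :: "nat \<Rightarrow> (nat \<times> nat \<Rightarrow> int) set" where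
  "int_span n = {x. \<exists>c. x = (\<lambda>q. \<Sum>p\<in>grid n. c p * symp_basis n p q)}"

lemma int_span_basis: "p \<in> grid n \<Longrightarrow> symp_basis n p \<in> int_span n"
  unfolding int_span_def
  by (intro CollectI exI[of _ "\<lambda>r. of_bool (r = p)"] ext)
    (simp add: of_bool_def if_distribR if_distrib[of "\<lambda>x. x * _"] sum.delta cong: if_cong)

lemma int_span_add: "x \<in> int_span n \<Longrightarrow> y \<in> int_span n \<Longrightarrow> (\<lambda>p. x p + y p) \<in> int_span n"
proof -
  assume "x \<in> int_span n" "y \<in> int_span n"
  then obtain c d where "x = (\<lambda>q. \<Sum>p\<in>grid n. c p * symp_basis n p q)"
    "y = (\<lambda>q. \<Sum>p\<in>grid n. d p * symp_basis n p q)" by (auto simp: int_span_def)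
  then show ?thesis
    unfolding int_span_def
    by (intro CollectI exI[of _ "\<lambda>p. c p + d p"]) (simp add: algebra_simps sum.distrib)
qed

lemma int_span_diff: "x \<in> int_span n \<Longrightarrow> y \<in> int_span n \<Longrightarrow> (\<lambda>p. x p - y p) \<in> int_span n"
proof -
  assume "x \<in> int_span n" "y \<in> int_span n"
  then obtain c d where "x = (\<lambda>q. \<Sum>p\<in>grid n. c p * symp_basis n p q)"
    "y = (\<lambda>q. \<Sum>p\<in>grid n. d p * symp_basis n p q)" by (auto simp: int_span_def)
  then show ?thesis
    unfolding int_span_def
    by (intro CollectI exI[of _ "\<lambda>p. c p - d p"]) (simp add: algebra_simps sum_subtractf)
qed

lemma int_span_zero: "(\<lambda>p. 0) \<in> int_span n"
  unfolding int_span_def by (intro CollectI exI[of _ "\<lambda>p. 0"]) simp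

lemma int_span_sum:
  assumes "\<And>a. a \<in> A \<Longrightarrow> f a \<in> int_span n"
  shows "(\<lambda>p. \<Sum>a\<in>A. f a p) \<in> int_span n"
  using assms
  by (induction A rule: infinite_finite_induct) (auto intro: int_span_zero int_span_add)

lemma int_span_psi: "t < n \<Longrightarrow> psi s t \<in> int_span n"
  using int_span_basis[of "(t, s)" n] int_span_zero[of n]
  by (cases "s < t") (auto simp: symp_basis_def psi_outside)

lemma int_span_sum_psi:
  assumes "A \<subseteq> {(s, t). s < t \<and> t < n}"
  shows "(\<lambda>p. \<Sum>(s, t)\<in>A. psi s t p) \<in> int_span n"
proof -
  have "(\<lambda>p. \<Sum>a\<in>A. (case a of (s, t) \<Rightarrow> psi s t) p) \<in> int_span n"
    using assms by (intro int_span_sum) (auto intro: int_span_psi)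
  then show ?thesis by (simp add: case_prod_beta)
qed

lemma int_span_unit_le:
  assumes "i \<le> j" "j < n"
  shows "unit (i, j) \<in> int_span n"
proof (cases "i < j")
  case True
  have "(\<lambda>p. symp_basis n (i, j) p + (\<Sum>(s, t)\<in>inside i j. psi s t p)) \<in> int_span n"
    using assms by (intro int_span_add int_span_basis int_span_sum_psi) (auto simp: inside_def)
  then show ?thesis using True by (simp add: symp_basis_def)
next
  case False
  have "(\<lambda>p. symp_basis n (i, i) p - (\<Sum>(s, t)\<in>around n i. psi s t p)) \<in> int_span n"
    using assms by (intro int_span_diff int_span_basis int_span_sum_psi) (auto simp: around_def)
  then show ?thesis using False assms by (simp add: symp_basis_def)
qed

lemma int_span_phi: 
  assumes "s < t" "t < n"
  shows "phi s t \<in> int_span n"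
proof -
  have "(\<lambda>p. psi s t p - psi (s + 1) (t - 1) p) \<in> int_span n"
    using assms by (intro int_span_diff int_span_psi) auto
  then show ?thesis using assms by (subst (asm) psi.simps) simp
qed

lemma tensor_delta:
  "tensor (delta a) (delta b) p
     = unit (a, b) p - unit (a, b + 1) p - unit (a + 1, b) p + unit (a + 1, b + 1) p"
  by (cases p) (auto simp: tensor_def delta_def unit_def)

text \<open>
  Expanding \<^term>\<open>phi s t\<close> into units, its outermost part is \<open>unit (s, t) + unit (t, s)\<close> with sign
  \<open>-\<close>; the remaining parts are of the same kind for shorter intervals. So all of these symmetric
  tensors are obtained from the diagonal units by induction on the length.
\<close>

lemma int_span_unit_plus_swap:
  assumes "s \<le> t" "t < n"
  shows "(\<lambda>p. unit (s, t) p + unit (t, s) p) \<in> int_span n"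
  using assms
proof (induction "t - s" arbitrary: s t rule: less_induct)
  case less
  consider "t = s" | "t = s + 1" | "s + 2 \<le> t" using less.prems by linarith
  then show ?case
  proof cases
    case 1
    then show ?thesis
      using int_span_add[OF int_span_unit_le int_span_unit_le, of s s n s s] less.prems by simp
  next
    case 2
    have "(\<lambda>p. (unit (s, s) p + unit (t, t) p) - phi s t p) \<in> int_span n"
      using 2 less.prems by (intro int_span_diff int_span_add int_span_unit_le int_span_phi) auto
    then show ?thesis
      using 2 by (simp add: phi_def tensor_delta algebra_simps)
  next
    case 3
    define R where "R = (\<lambda>a b p. unit (a, b) p + unit (b, a) p)"
    have R: "R s (t - 1) \<in> int_span n" "R (s + 1) (t - 1) \<in> int_span n" "R (s + 1) t \<in> int_span n"
      unfolding R_def using 3 less.prems by (intro less.hyps; simp)+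
    then have "(\<lambda>p. ((R s (t - 1) p - R (s + 1) (t - 1) p) + R (s + 1) t p) - phi s t p) \<in> int_span n"
      using 3 less.prems by (intro int_span_diff int_span_add int_span_phi) auto
    moreover obtain m where "t = Suc m" using 3 by (cases t) auto
    ultimately have "R s t \<in> int_span n"
      using 3 by (simp add: phi_def tensor_delta R_def algebra_simps)
    then show ?thesis by (simp add: R_def)
  qed
qed

lemma int_span_unit:
  assumes "p \<in> grid n"
  shows "unit p \<in> int_span n"
proof -
  obtain i j where p: "p = (i, j)" by (cases p)
  show ?thesis
  proof (cases "i \<le> j")
    case True
    then show ?thesis using assms p int_span_unit_le by simp
  next
    case False
    then have "(\<lambda>q. (unit (j, i) q + unit (i, j) q) - unit (j, i) q) \<in> int_span n"
      using assms p by (intro int_span_diff int_span_unit_plus_swap int_span_unit_le) auto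
    then show ?thesis using p by simp
  qed
qed


text \<open>
  The coordinates of the units in terms of the family are the entries of a left inverse of its matrix.
\<close>

lemma symp_basis_unimodular:
  "\<exists>c. \<forall>p\<in>grid n. \<forall>r. (\<Sum>q\<in>grid n. c p q * symp_basis n q r) = of_bool (r = p)"
proof -
  have "\<forall>p\<in>grid n. \<exists>c. \<forall>r. (\<Sum>q\<in>grid n. c q * symp_basis n q r) = of_bool (r = p)"
  proof
    fix p assume "p \<in> grid n"
    then obtain c where "unit p = (\<lambda>r. \<Sum>q\<in>grid n. c q * symp_basis n q r)"
      using int_span_unit[of p n] unfolding int_span_def by blast
    then have "\<forall>r. (\<Sum>q\<in>grid n. c q * symp_basis n q r) = of_bool (r = p)"
      by (metis unit_def)
    then show "\<exists>c. \<forall>r. (\<Sum>q\<in>grid n. c q * symp_basis n q r) = of_bool (r = p)" by blast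
  qed
  then show ?thesis by (rule bchoice)
qed

section \<open>Enumerations of the grid\<close>

text \<open>
  Without the reversal of the second index, exchanging the factors would preserve the form instead of
  changing its sign.
\<close>

definition reversed_pair :: "nat \<Rightarrow> nat \<Rightarrow> nat \<times> nat" where
  "reversed_pair n k = (k div n, n - 1 - k mod n)"

lemma card_grid: "card (grid n) = n\<^sup>2"
  by (simp add: grid_def power2_eq_square)

text \<open>Both sides have \<open>n\<^sup>2\<close> elements, so surjectivity suffices.\<close>

lemma bij_betw_grid:
  assumes "e ` {..<n\<^sup>2} = grid n"
  shows "bij_betw e {..<n\<^sup>2} (grid n)"
  using assms by (auto simp: bij_betw_def card_grid intro: eq_card_imp_inj_on)

lemma bij_reversed_pair: "bij_betw (reversed_pair n) {..<n\<^sup>2} (grid n)"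
proof (intro bij_betw_grid equalityI subsetI)
  fix p assume "p \<in> reversed_pair n ` {..<n\<^sup>2}"
  then obtain k where "k < n * n" "p = reversed_pair n k" by (auto simp: power2_eq_square)
  moreover from this have "0 < n" by (cases n) auto
  ultimately show "p \<in> grid n"
    by (auto simp: reversed_pair_def less_mult_imp_div_less)
next
  fix p assume "p \<in> grid n"
  then obtain i j where p: "p = (i, j)" "i < n" "j < n" by (cases p) auto
  define k where "k = i * n + (n - 1 - j)"
  have "k < (i + 1) * n" using p by (simp add: k_def)
  also have "\<dots> \<le> n * n" using p by (intro mult_right_mono) auto
  finally have "k < n\<^sup>2" by (simp add: power2_eq_square)
  moreover have "reversed_pair n k = p"
  proof -
    define m where "m = n - 1 - j"
    have m: "m < n" "n - 1 - m = j" using p by (auto simp: m_def)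
    have "k div n = i" "k mod n = m"
      using m unfolding k_def m_def[symmetric] by auto
    then show ?thesis using p m by (simp add: reversed_pair_def)
  qed
  ultimately show "p \<in> reversed_pair n ` {..<n\<^sup>2}" by (intro image_eqI[of _ _ k]) auto
qed

lemma rel_exponent_lex_pair:
  assumes "0 < n"
  shows "rel_exponent (lex_pair n k) (lex_pair n l) = - 2 * nest (reversed_pair n k) (reversed_pair n l)"
proof -
  define i j s t where "i = k div n" and "j = k mod n" and "s = l div n" and "t = l mod n"
  have "j < n" "t < n" using assms by (auto simp: j_def t_def)
  then have less: "n - Suc t < n - Suc j \<longleftrightarrow> j < t" "n - Suc j < n - Suc t \<longleftrightarrow> t < j" by auto
  have "rel_exponent (i + 1, j + 1) (s + 1, t + 1) = - 2 * nest (i, n - 1 - j) (s, n - 1 - t)"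
    by (auto simp: rel_exponent_def nest_def less mult_le_0_iff)
  then show ?thesis
    by (simp add: lex_pair_def reversed_pair_def i_def j_def s_def t_def)
qed

definition upper_pairs :: "nat \<Rightarrow> (nat \<times> nat) set" where
  "upper_pairs n = {(i, j). i < j \<and> j < n}"

lemma double_card_upper_pairs: "2 * card (upper_pairs n) = n\<^sup>2 - n"
proof -
  have "upper_pairs n = prod.swap ` (SIGMA j:{..<n}. {..<j})"
    by (auto simp: upper_pairs_def image_def)
  then have "card (upper_pairs n) = (\<Sum>j<n. j)"
    by (simp add: card_image)
  moreover have "2 * (\<Sum>j<n. j) + n = n\<^sup>2" for n :: nat
    by (induction n) (auto simp: power2_eq_square)
  ultimately show ?thesis by (metis add_diff_cancel_right')
qed

text \<open>
  The order in which the symplectic family yields the canonical form: each pair above the diagonal,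
  as enumerated by \<open>f\<close>, is followed immediately by its transpose, and the kernel comes last.
\<close>

definition paired_enum :: "(nat \<Rightarrow> nat \<times> nat) \<Rightarrow> nat \<Rightarrow> nat \<Rightarrow> nat \<times> nat" where
  "paired_enum f N k = (if k < 2 * N then if even k then f (k div 2) else prod.swap (f (k div 2))
     else (k - 2 * N, k - 2 * N))"

lemma bij_paired_enum:
  assumes f: "bij_betw f {..<N} (upper_pairs n)" and n: "n\<^sup>2 = 2 * N + n"
  shows "bij_betw (paired_enum f N) {..<n\<^sup>2} (grid n)"
proof (intro bij_betw_grid equalityI subsetI)
  fix p assume "p \<in> paired_enum f N ` {..<n\<^sup>2}"
  then obtain k where k: "k < n\<^sup>2" "p = paired_enum f N k" by auto
  show "p \<in> grid n"
  proof (cases "k < 2 * N")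
    case True
    then have "f (k div 2) \<in> upper_pairs n" using f by (auto simp: bij_betw_def)
    then show ?thesis using k True by (auto simp: paired_enum_def upper_pairs_def)
  next
    case False
    then show ?thesis using k n by (simp add: paired_enum_def)
  qed
next
  fix p assume "p \<in> grid n"
  then obtain i j where p: "p = (i, j)" "i < n" "j < n" by (cases p) auto
  consider "i < j" | "j < i" | "i = j" by linarith
  then show "p \<in> paired_enum f N ` {..<n\<^sup>2}"
  proof cases
    case 1
    then have "(i, j) \<in> f ` {..<N}" using f p by (auto simp: bij_betw_def upper_pairs_def)
    then obtain a where "a < N" "f a = (i, j)" by auto
    then show ?thesis using p n
      by (intro image_eqI[of _ _ "2 * a"]) (auto simp: paired_enum_def)
  next
    case 2
    then have "(j, i) \<in> f ` {..<N}" using f p by (auto simp: bij_betw_def upper_pairs_def)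
    then obtain a where "a < N" "f a = (j, i)" by auto
    then show ?thesis using p n
      by (intro image_eqI[of _ _ "2 * a + 1"]) (auto simp: paired_enum_def)
  next
    case 3
    then show ?thesis using p n
      by (intro image_eqI[of _ _ "2 * N + i"]) (auto simp: paired_enum_def)
  qed
qed

definition block_entry :: "nat \<Rightarrow> nat \<times> nat \<Rightarrow> int" where
  "block_entry N = (\<lambda>(k, l). if k < 2 * N \<and> k div 2 = l div 2 \<and> k \<noteq> l then if even k then 2 else - 2 else 0)"

lemma form_paired_enum:
  assumes f: "bij_betw f {..<N} (upper_pairs n)" and n: "n\<^sup>2 = 2 * N + n"
    and kl: "k < n\<^sup>2" "l < n\<^sup>2"
  shows "- 2 * form n (symp_basis n (paired_enum f N k)) (symp_basis n (paired_enum f N l)) = block_entry N (k, l)"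
proof -
  note bij = bij_paired_enum[OF f n]
  let ?e = "paired_enum f N"
  have in_grid: "?e k \<in> grid n" "?e l \<in> grid n"
    using kl bij by (auto simp: bij_betw_def)
  show ?thesis
  proof (cases "k < 2 * N")
    case False
    then show ?thesis using in_grid by (simp add: form_symp_basis block_entry_def) (simp add: paired_enum_def)
  next
    case True
    \<comment> \<open>the position of the transposed pair, within the same block of two\<close>
    define k' where "k' = (if even k then k + 1 else k - 1)"
    have k': "k' < 2 * N" "k' div 2 = k div 2" "even k' \<longleftrightarrow> odd k"
      using True by (auto simp: k'_def elim!: evenE oddE)
    have "?e k' = prod.swap (?e k)"
      using True k' by (simp add: paired_enum_def)
    moreover have "?e l = ?e k' \<longleftrightarrow> l = k'"
      using bij kl k' n by (auto simp: bij_betw_def inj_on_eq_iff)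
    moreover have "l = k' \<longleftrightarrow> k div 2 = l div 2 \<and> k \<noteq> l"
      by (auto simp: k'_def elim!: evenE oddE)
    moreover have "f (k div 2) \<in> upper_pairs n" using f True by (auto simp: bij_betw_def)
    ultimately show ?thesis
      using in_grid True
      by (simp add: form_symp_basis block_entry_def)
        (auto simp: paired_enum_def upper_pairs_def)
  qed
qed

section \<open>Matrices\<close>

lemma mult_mat_mat:
  "mat d d f * mat d d g = mat d d (\<lambda>(i, j). \<Sum>k<d. f (i, k) * g (k, j) :: int)"
  by (intro eq_matI) (auto simp: scalar_prod_def lessThan_atLeast0)

lemma transpose_mat_mat: "transpose_mat (mat d d f) = mat d d (\<lambda>(i, j). f (j, i))"
  by (intro eq_matI) auto

lemma diag_block_replicate:
  assumes "B \<in> carrier_mat 2 2"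
  shows "diag_block_mat (replicate N B)
    = mat (2 * N) (2 * N) (\<lambda>(k, l). if k div 2 = l div 2 then B $$ (k mod 2, l mod 2) else (0 :: int))"
proof (induction N)
  case 0
  then show ?case by (intro eq_matI) auto
next
  case (Suc N)
  show ?case
  proof (intro eq_matI)
    fix k l
    let ?R = "mat (2 * Suc N) (2 * Suc N) (\<lambda>(k, l). if k div 2 = l div 2 then B $$ (k mod 2, l mod 2) else 0)"
    assume "k < dim_row ?R" "l < dim_col ?R"
    then have kl: "k < 2 * Suc N" "l < 2 * Suc N" by simp_all
    have entry: "diag_block_mat (replicate (Suc N) B) $$ (k, l) =
        (if k < 2 then if l < 2 then B $$ (k, l) else 0
         else if l < 2 then 0
         else if (k - 2) div 2 = (l - 2) div 2 then B $$ ((k - 2) mod 2, (l - 2) mod 2) else 0)"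
      using kl assms by (simp add: Suc Let_def)
    show "diag_block_mat (replicate (Suc N) B) $$ (k, l) = ?R $$ (k, l)"
    proof (cases "k < 2"; cases "l < 2")
      assume "\<not> k < 2" "\<not> l < 2"
      then obtain k' l' where "k = k' + 2" "l = l' + 2" by (metis le_add_diff_inverse2 not_less)
      then show ?thesis unfolding entry using kl by simp
    qed (use entry kl in \<open>auto simp: less_2_cases_iff\<close>)
  qed (use assms in \<open>auto simp: Suc Let_def\<close>)
qed

lemma diag_block_zero: "diag_block_mat (replicate k (0\<^sub>m a a)) = (0\<^sub>m (k * a) (k * a) :: int mat)"
  by (induction k) (auto simp: Let_def four_block_mat_def intro!: eq_matI)

text \<open>
  If the last row of \<open>W\<close> lies in the kernel of the form, negating it changes the sign of
  \<open>det W\<close> but not the product.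
\<close>

lemma SL_int_fix_sign:
  assumes W: "W \<in> carrier_mat d d" and M: "M \<in> carrier_mat d d" and d: "0 < d"
    and det: "det W = 1 \<or> det W = - 1"
    and C: "C = W * M * transpose_mat W"
    and zero: "\<And>k. k < d \<Longrightarrow> C $$ (d - 1, k) = 0 \<and> C $$ (k, d - 1) = 0"
  shows "\<exists>W'\<in>SL_int d. C = W' * M * transpose_mat W'"
proof (cases "det W = 1")
  case True
  then show ?thesis using W C by (auto simp: SL_int_def)
next
  case False
  define E :: "int mat" where "E = multrow_mat d (d - 1) (- 1)"
  have E: "E \<in> carrier_mat d d" by (simp add: E_def)
  have carr: "C \<in> carrier_mat d d" using W M C by auto
  have EC: "E * C = C"
    unfolding E_def multrow_mat[OF carr, symmetric]
    using carr zero by (intro eq_matI) auto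
  have ECt: "E * transpose_mat C = transpose_mat C"
    unfolding E_def multrow_mat[OF transpose_carrier_mat[THEN iffD2, OF carr], symmetric]
    using carr zero by (intro eq_matI) auto
  have CE: "C * transpose_mat E = C"
    using arg_cong[OF ECt, of transpose_mat] E carr by (simp add: transpose_mult)
  have "(E * W) * M * transpose_mat (E * W) = E * C * transpose_mat E"
    using E W M by (simp add: C transpose_mult[of _ d d _ d] assoc_mult_mat[of _ d d _ d _ d])
  also have "\<dots> = C" by (simp add: EC CE)
  finally have "C = (E * W) * M * transpose_mat (E * W)" ..
  moreover have "det (E * W) = 1"
    using False det d det_mult[OF E W] by (simp add: E_def det_multrow_mat)
  moreover have "E * W \<in> carrier_mat d d" using E W by simp
  ultimately show ?thesis unfolding SL_int_def by blast
qed

text \<open>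
  The rows of \<open>W\<close> are the coordinates of the symplectic family. The sign can be corrected in its last
  row, which belongs to the kernel because \<open>0 < n\<close>.
\<close>

lemma defining_matrix_congruent:
  assumes n: "0 < n" and N: "n\<^sup>2 = 2 * N + n" and f: "bij_betw f {..<N} (upper_pairs n)"
  shows "\<exists>W\<in>SL_int (n\<^sup>2). mat (n\<^sup>2) (n\<^sup>2) (block_entry N)
    = W * defining_matrix n * transpose_mat W"
proof -
  define d where "d = n\<^sup>2"
  define e where "e = paired_enum f N"
  define W where "W = mat d d (\<lambda>(k, l). symp_basis n (e k) (reversed_pair n l))"
  have rev: "bij_betw (reversed_pair n) {..<d} (grid n)"
    unfolding d_def by (rule bij_reversed_pair)
  have e: "bij_betw e {..<d} (grid n)"
    unfolding d_def e_def by (rule bij_paired_enum[OF f N])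
  have M: "defining_matrix n = mat d d (\<lambda>(k, l). - 2 * nest (reversed_pair n k) (reversed_pair n l))"
    using n by (simp add: defining_matrix_def d_def rel_exponent_lex_pair)
  have "W * defining_matrix n * transpose_mat W = mat d d (\<lambda>(k, l). block_entry N (k, l))"
  proof -
    have "(\<Sum>b<d. (\<Sum>a<d. symp_basis n (e k) (reversed_pair n a)
          * (- 2 * nest (reversed_pair n a) (reversed_pair n b))) * symp_basis n (e l) (reversed_pair n b))
        = block_entry N (k, l)" if "k < d" "l < d" for k l
    proof -
      have "(\<Sum>b<d. (\<Sum>a<d. symp_basis n (e k) (reversed_pair n a)
          * (- 2 * nest (reversed_pair n a) (reversed_pair n b))) * symp_basis n (e l) (reversed_pair n b))
        = (\<Sum>q\<in>grid n. (\<Sum>a<d. symp_basis n (e k) (reversed_pair n a)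
          * (- 2 * nest (reversed_pair n a) q)) * symp_basis n (e l) q)"
        by (rule sum.reindex_bij_betw[OF rev])
      also have "\<dots> = (\<Sum>q\<in>grid n. (\<Sum>p\<in>grid n. symp_basis n (e k) p
          * (- 2 * nest p q)) * symp_basis n (e l) q)"
        by (intro sum.cong refl arg_cong2[of _ _ _ _ "(*)"] sum.reindex_bij_betw[OF rev])
      also have "\<dots> = (\<Sum>q\<in>grid n. \<Sum>p\<in>grid n. - 2 * (symp_basis n (e k) p * nest p q * symp_basis n (e l) q))"
        unfolding sum_distrib_right by (intro sum.cong refl) simp
      also have "\<dots> = - 2 * form n (symp_basis n (e k)) (symp_basis n (e l))"
        unfolding form_def sum_distrib_left by (rule sum.swap)
      also have "\<dots> = block_entry N (k, l)"
        using form_paired_enum[OF f N] that by (simp add: e_def d_def)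
      finally show ?thesis .
    qed
    then show ?thesis
      unfolding W_def M transpose_mat_mat mult_mat_mat
      by (intro eq_matI) auto
  qed
  then have C: "mat d d (block_entry N) = W * defining_matrix n * transpose_mat W"
    by simp
  obtain c where c: "\<And>p r. p \<in> grid n \<Longrightarrow> (\<Sum>q\<in>grid n. c p q * symp_basis n q r) = of_bool (r = p)"
    using symp_basis_unimodular[of n] by blast
  define V where "V = mat d d (\<lambda>(l, k). c (reversed_pair n l) (e k))"
  have "(\<Sum>k<d. c (reversed_pair n l) (e k) * symp_basis n (e k) (reversed_pair n m)) = of_bool (l = m)"
    if "l < d" "m < d" for l m
  proof -
    have "(\<Sum>k<d. c (reversed_pair n l) (e k) * symp_basis n (e k) (reversed_pair n m))
      = (\<Sum>q\<in>grid n. c (reversed_pair n l) q * symp_basis n q (reversed_pair n m))"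
      by (rule sum.reindex_bij_betw[OF e])
    also have "\<dots> = of_bool (reversed_pair n m = reversed_pair n l)"
      using rev that by (intro c) (auto simp: bij_betw_def)
    also have "\<dots> = of_bool (l = m)"
      using rev that by (auto simp: bij_betw_def inj_on_eq_iff)
    finally show ?thesis .
  qed
  then have "V * W = 1\<^sub>m d"
    unfolding V_def W_def mult_mat_mat by (intro eq_matI) auto
  then have "det V * det W = 1"
    using det_mult[of V d W] by (simp add: V_def W_def)
  then have det: "det W = 1 \<or> det W = - 1"
    by (metis zmult_eq_1_iff)
  have "\<exists>W'\<in>SL_int d. mat d d (block_entry N) = W' * defining_matrix n * transpose_mat W'"
  proof (rule SL_int_fix_sign[OF _ _ _ det C])
    fix k assume "k < d"
    have "2 * N \<le> d - 1" "0 < d" using n N by (auto simp: d_def)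
    then have "k div 2 \<noteq> (d - 1) div 2" if "k < 2 * N"
      using that by (metis less_mult_imp_div_less mult.commute div_le_mono nonzero_mult_div_cancel_left
          not_less zero_neq_numeral)
    then have "block_entry N (d - 1, k) = 0" "block_entry N (k, d - 1) = 0"
      using \<open>2 * N \<le> d - 1\<close> by (auto simp: block_entry_def)
    then show "mat d d (block_entry N) $$ (d - 1, k) = 0 \<and> mat d d (block_entry N) $$ (k, d - 1) = 0"
      using \<open>k < d\<close> by simp
  qed (use n in \<open>auto simp: W_def M d_def\<close>)
  then show ?thesis by (simp add: d_def)
qed

lemma skew_symmetric_defining_matrix:
  assumes "0 < n"
  shows "skew_symmetric_mat (defining_matrix n)"
proof -
  have "transpose_mat (defining_matrix n) = - defining_matrix n"
  proof (intro eq_matI)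
    fix k l assume "k < dim_row (- defining_matrix n)" "l < dim_col (- defining_matrix n)"
    then show "transpose_mat (defining_matrix n) $$ (k, l) = (- defining_matrix n) $$ (k, l)"
      using assms nest_skew[of "reversed_pair n k" "reversed_pair n l"]
      by (simp add: defining_matrix_def rel_exponent_lex_pair)
  qed (simp_all add: defining_matrix_def)
  then show ?thesis by (simp add: skew_symmetric_mat_def defining_matrix_def)
qed

lemma block_diagonal_entries:
  "diag_block_mat (replicate N (skew_block (- 2)) @ replicate m (0\<^sub>m 1 1))
    = mat (2 * N + m) (2 * N + m) (block_entry N)"
proof -
  have carr: "skew_block (- 2) \<in> carrier_mat 2 2"
    by (simp add: skew_block_def mat_of_rows_list_def numeral_2_eq_2)
  have ent: "skew_block (- 2) $$ (k mod 2, l mod 2) = (if k mod 2 = l mod 2 then 0 else if even k then 2 else - 2)"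
    for k l :: nat
    by (cases "even k"; cases "even l")
      (auto simp: skew_block_def mat_of_rows_list_def even_iff_mod_2_eq_zero odd_iff_mod_2_eq_one)
  have eq: "k mod 2 = l mod 2 \<longleftrightarrow> k = l" if "k div 2 = l div 2" for k l :: nat
    using that by (metis div_mult_mod_eq)
  have same: "l < 2 * N" if "k div 2 = l div 2" "k < 2 * N" for k l
    using that by presburger
  let ?A = "diag_block_mat (replicate N (skew_block (- 2)))"
  have A: "?A = mat (2 * N) (2 * N) (block_entry N)"
    unfolding diag_block_replicate[OF carr]
  proof (intro eq_matI)
    fix k l assume "k < dim_row (mat (2 * N) (2 * N) (block_entry N))"
      "l < dim_col (mat (2 * N) (2 * N) (block_entry N))"
    then show "mat (2 * N) (2 * N) (\<lambda>(k, l). if k div 2 = l div 2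
        then skew_block (- 2) $$ (k mod 2, l mod 2) else 0) $$ (k, l)
      = mat (2 * N) (2 * N) (block_entry N) $$ (k, l)"
      using eq[of k l] by (simp add: block_entry_def ent)
  qed auto
  have zero: "block_entry N (k, l) = 0" if "\<not> (k < 2 * N \<and> l < 2 * N)" for k l
    using that same[of k l] by (auto simp: block_entry_def)
  show ?thesis
    unfolding diag_block_mat_append A diag_block_zero Let_def
    by (intro eq_matI) (auto simp: zero)
qed

text \<open>
  Canonical shapes have at most one \<open>1 \<times> 1\<close> zero block, so the zeros are regrouped into blocks
  \<open>skew_block 0\<close>, with one left over if their number is odd.
\<close>

lemma canonical_shape_blocks:
  "canonical_shape (diag_block_mat (replicate N (skew_block a) @ replicate m (0\<^sub>m 1 1)))"
proof -
  have zero: "skew_block 0 = 0\<^sub>m 2 2"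
    by (intro eq_matI) (auto simp: skew_block_def mat_of_rows_list_def less_2_cases_iff)
  define ms where "ms = replicate N a @ replicate (m div 2) 0"
  have ms: "map skew_block ms = replicate N (skew_block a) @ replicate (m div 2) (0\<^sub>m 2 2)"
    by (simp add: ms_def zero)
  show ?thesis
  proof (cases "even m")
    case True
    then have "diag_block_mat (replicate (m div 2) (0\<^sub>m 2 2)) = diag_block_mat (replicate m (0\<^sub>m 1 1) :: int mat list)"
      by (simp add: diag_block_zero)
    then show ?thesis
      unfolding canonical_shape_def
      by (intro exI[of _ ms] disjI1) (simp add: ms diag_block_mat_append)
  next
    case False
    then have "m = m div 2 * 2 + 1" by presburger
    then have "diag_block_mat (replicate (m div 2) (0\<^sub>m 2 2) @ [0\<^sub>m 1 1]) = (0\<^sub>m m m :: int mat)"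
      unfolding diag_block_mat_append diag_block_zero Let_def
      by (intro eq_matI) auto
    then have "diag_block_mat (replicate (m div 2) (0\<^sub>m 2 2) @ [0\<^sub>m 1 1])
        = diag_block_mat (replicate m (0\<^sub>m 1 1) :: int mat list)"
      by (simp add: diag_block_zero)
    then show ?thesis
      unfolding canonical_shape_def ms append_assoc
      by (intro exI[of _ ms] disjI2)
        (simp only: ms append_assoc diag_block_mat_append[of "replicate N (skew_block a)"])
  qed
qed

theorem theorem7p6:
  fixes n N :: nat and D :: "nat \<Rightarrow> int mat"
  assumes "n \<ge> 1"
    and "N = (n\<^sup>2 - n) div 2"
    and "\<And>i. i \<in> {1..N} \<Longrightarrow> D i = mat_of_rows_list 2 [[0, 2], [- 2, 0]]"
  shows "is_canonical_form (defining_matrix n)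
           (diag_block_mat (map D [1..<N + 1] @ replicate (n\<^sup>2 - 2 * N) (0\<^sub>m 1 1)))"
proof -
  have card: "card (upper_pairs n) = N"
    using assms(2) double_card_upper_pairs[of n] by simp
  have "finite (upper_pairs n)"
    by (rule finite_subset[OF _ finite_grid[of n]]) (auto simp: upper_pairs_def)
  then obtain f where f: "bij_betw f {..<N} (upper_pairs n)"
    using ex_bij_betw_nat_finite card by (metis lessThan_atLeast0)
  have "n \<le> n\<^sup>2" by (simp add: power2_eq_square)
  then have N: "n\<^sup>2 = 2 * N + n"
    using card double_card_upper_pairs[of n] by simp
  have "map D [1..<N + 1] = replicate N (skew_block (- 2))"
    using assms(3) by (intro replicate_eqI) (auto simp: skew_block_def)
  moreover have "dim_row (defining_matrix n) = n\<^sup>2"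
    by (simp add: defining_matrix_def)
  moreover have "n\<^sup>2 - 2 * N = n" "2 * N + n = n\<^sup>2" "0 < n"
    using N assms(1) by simp_all
  ultimately show ?thesis
    using defining_matrix_congruent[OF _ N f] skew_symmetric_defining_matrix[of n]
      canonical_shape_blocks[of N "- 2" n]
    by (simp only: is_canonical_form_def block_diagonal_entries simp_thms)
qed

end
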